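(* Let $\Phi=(G,\varphi)$ be a distance compatible $\mathbb{T}$-gain graph on a connected simple graph $G$ with $n$ vertices. Then $\rho(\mathcal{DL}(\Phi))\le\rho(\mathcal{DQ}(G))$, with equality if and only if $\Phi$ is switching equivalent to $(K_n,-1)$, the complete graph on $n$ vertices with every oriented edge having gain $-1$.
   Context: $\mathbb{T}=\{z\in\mathbb{C}:|z|=1\}$. A $\mathbb{T}$-gain graph $\Phi=(G,\varphi)$ assigns to each of the two orientations $\vec e_{i,j},\vec e_{j,i}$ of every edge $v_iv_j$ of $G$ a gain in $\mathbb{T}$ with $\varphi(\vec e_{j,i})=\overline{\varphi(\vec e_{i,j})}$; the gain of an oriented path is the product of the gains of its consecutive oriented edges. Two gain graphs $(G,\varphi),(G,\psi)$ on the same graph are switching equivalent if there is $\zeta:V(G)\to\mathbb{T}$ with $\varphi(\vec e_{i,j})=\zeta(v_i)^{-1}\psi(\vec e_{i,j})\zeta(v_j)$ for every edge. $d(u,v)$ is the shortest-path distance in $G$; $\mathcal{D}(G)=(d(v_i,v_j))$. For a total order $<$ and $s<t$, $\varphi^{<}_{\max}(s,t)$ (resp. $\varphi^{<}_{\min}(s,t)$) is the maximum (resp. minimum) of the gains of all shortest oriented paths from $s$ to $t$, with respect to the lexicographic order on $\mathbb{C}$ ($a+ib\le c+id$ iff $a<c$, or $a=c$ and $b\le d$); further $\varphi^{<}_{\max}(t,s)=\overline{\varphi^{<}_{\max}(s,t)}$, $\varphi^{<}_{\min}(t,s)=\overline{\varphi^{<}_{\min}(s,t)}$, and both vanish on pairs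 $(s,s)$. $\mathcal{D}^{\max}_{<}(\Phi)=(\varphi^{<}_{\max}(v_i,v_j)d(v_i,v_j))_{i,j}$, $\mathcal{D}^{\min}_{<}(\Phi)=(\varphi^{<}_{\min}(v_i,v_j)d(v_i,v_j))_{i,j}$. $\Phi$ is distance compatible if $\mathcal{D}^{\max}_{<}(\Phi)=\mathcal{D}^{\min}_{<}(\Phi)$ for the standard order $v_1<\dots<v_n$; the common matrix is $\mathcal{D}(\Phi)$. With $\mathrm{Tr}(G)=\mathrm{diag}(\mathrm{Tr}(v_1),\dots,\mathrm{Tr}(v_n))$, $\mathrm{Tr}(v_i)=\sum_j d(v_i,v_j)$: $\mathcal{DL}(\Phi)=\mathrm{Tr}(G)-\mathcal{D}(\Phi)$ and $\mathcal{DQ}(G)=\mathrm{Tr}(G)+\mathcal{D}(G)$. $\rho(M)$ denotes the spectral radius of $M$. *)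

theory Defs
  imports
    "Graph_Theory.Kuratowski"
    "Jordan_Normal_Form.Spectral_Radius"
begin

text \<open>
  A simple graph is a \<^locale>\<open>pair_graph\<close>: a finite, loop-free, symmetric set of arcs, in which
  the arcs \<open>(u, v)\<close> and \<open>(v, u)\<close> are the two orientations of the edge \<open>uv\<close>. A gain function is
  total on pairs; its values off the arcs of the graph are irrelevant.
\<close>

definition gain_graph :: "'a pair_pre_digraph \<Rightarrow> ('a \<times> 'a \<Rightarrow> complex) \<Rightarrow> bool" where
  "gain_graph G \<phi> \<longleftrightarrow> pair_graph G \<and>
     (\<forall>(u, v) \<in> parcs G. cmod (\<phi> (u, v)) = 1 \<and> \<phi> (v, u) = cnj (\<phi> (u, v)))"

definition path_gain :: "('a \<times> 'a \<Rightarrow> complex) \<Rightarrow> ('a \<times> 'a) awalk \<Rightarrow> complex" where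
  "path_gain \<phi> p = prod_list (map \<phi> p)"

definition switching_equivalent ::
    "'a pair_pre_digraph \<Rightarrow> ('a \<times> 'a \<Rightarrow> complex) \<Rightarrow> ('a \<times> 'a \<Rightarrow> complex) \<Rightarrow> bool" where
  "switching_equivalent G \<phi> \<psi> \<longleftrightarrow>
     (\<exists>\<zeta>. (\<forall>v \<in> pverts G. cmod (\<zeta> v) = 1) \<and>
          (\<forall>(u, v) \<in> parcs G. \<phi> (u, v) = inverse (\<zeta> u) * \<psi> (u, v) * \<zeta> v))"

text \<open>Meaningful only if \<open>v\<close> is reachable from \<open>u\<close>.\<close>

definition gdist :: "'a pair_pre_digraph \<Rightarrow> 'a \<Rightarrow> 'a \<Rightarrow> nat" where
  "gdist G u v = (LEAST k. \<exists>p. pre_digraph.apath (with_proj G) u p v \<and> length p = k)"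

definition shortest_paths :: "'a pair_pre_digraph \<Rightarrow> 'a \<Rightarrow> 'a \<Rightarrow> ('a \<times> 'a) awalk set" where
  "shortest_paths G u v =
     {p. pre_digraph.apath (with_proj G) u p v \<and> length p = gdist G u v}"

definition lex_le :: "complex \<Rightarrow> complex \<Rightarrow> bool" where
  "lex_le z w \<longleftrightarrow> Re z < Re w \<or> (Re z = Re w \<and> Im z \<le> Im w)"

definition lex_Max :: "complex set \<Rightarrow> complex" where
  "lex_Max S = (THE z. z \<in> S \<and> (\<forall>w \<in> S. lex_le w z))"

definition lex_Min :: "complex set \<Rightarrow> complex" where
  "lex_Min S = (THE z. z \<in> S \<and> (\<forall>w \<in> S. lex_le z w))"

text \<open>In the next two definitions \<open>lt\<close> is the strict part of a total order on the vertices.\<close>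

definition gain_max ::
    "('a \<Rightarrow> 'a \<Rightarrow> bool) \<Rightarrow> 'a pair_pre_digraph \<Rightarrow> ('a \<times> 'a \<Rightarrow> complex) \<Rightarrow> 'a \<Rightarrow> 'a \<Rightarrow> complex" where
  "gain_max lt G \<phi> s t =
     (if s = t then 0
      else if lt s t then lex_Max (path_gain \<phi> ` shortest_paths G s t)
      else cnj (lex_Max (path_gain \<phi> ` shortest_paths G t s)))"

definition gain_min ::
    "('a \<Rightarrow> 'a \<Rightarrow> bool) \<Rightarrow> 'a pair_pre_digraph \<Rightarrow> ('a \<times> 'a \<Rightarrow> complex) \<Rightarrow> 'a \<Rightarrow> 'a \<Rightarrow> complex" where
  "gain_min lt G \<phi> s t =
     (if s = t then 0
      else if lt s t then lex_Min (path_gain \<phi> ` shortest_paths G s t)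
      else cnj (lex_Min (path_gain \<phi> ` shortest_paths G t s)))"

text \<open>
  The matrices are for graphs with vertex set \<open>{..<n}\<close>, the vertex \<open>i\<close> being $v_{i+1}$.
  All are taken over the complex numbers, since the spectral radius refers to complex eigenvalues.
\<close>

definition gain_dist_mat_max ::
    "(nat \<Rightarrow> nat \<Rightarrow> bool) \<Rightarrow> nat \<Rightarrow> nat pair_pre_digraph \<Rightarrow> (nat \<times> nat \<Rightarrow> complex) \<Rightarrow> complex mat" where
  "gain_dist_mat_max lt n G \<phi> =
     mat n n (\<lambda>(i, j). gain_max lt G \<phi> i j * of_nat (gdist G i j))"

definition gain_dist_mat_min ::
    "(nat \<Rightarrow> nat \<Rightarrow> bool) \<Rightarrow> nat \<Rightarrow> nat pair_pre_digraph \<Rightarrow> (nat \<times> nat \<Rightarrow> complex) \<Rightarrow> complex mat" where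
  "gain_dist_mat_min lt n G \<phi> =
     mat n n (\<lambda>(i, j). gain_min lt G \<phi> i j * of_nat (gdist G i j))"

definition distance_compatible ::
    "nat \<Rightarrow> nat pair_pre_digraph \<Rightarrow> (nat \<times> nat \<Rightarrow> complex) \<Rightarrow> bool" where
  "distance_compatible n G \<phi> \<longleftrightarrow> gain_dist_mat_max (<) n G \<phi> = gain_dist_mat_min (<) n G \<phi>"

text \<open>Used only for distance compatible gain graphs, where the choice of \<open>max\<close> is immaterial.\<close>

definition gain_dist_mat ::
    "nat \<Rightarrow> nat pair_pre_digraph \<Rightarrow> (nat \<times> nat \<Rightarrow> complex) \<Rightarrow> complex mat" where
  "gain_dist_mat n G \<phi> = gain_dist_mat_max (<) n G \<phi>"

definition dist_mat :: "nat \<Rightarrow> nat pair_pre_digraph \<Rightarrow> complex mat" where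
  "dist_mat n G = mat n n (\<lambda>(i, j). of_nat (gdist G i j))"

definition transmission :: "nat pair_pre_digraph \<Rightarrow> nat \<Rightarrow> nat" where
  "transmission G v = (\<Sum>u \<in> pverts G. gdist G v u)"

definition transmission_mat :: "nat \<Rightarrow> nat pair_pre_digraph \<Rightarrow> complex mat" where
  "transmission_mat n G = mat n n (\<lambda>(i, j). if i = j then of_nat (transmission G i) else 0)"

definition gain_dist_laplacian ::
    "nat \<Rightarrow> nat pair_pre_digraph \<Rightarrow> (nat \<times> nat \<Rightarrow> complex) \<Rightarrow> complex mat" where
  "gain_dist_laplacian n G \<phi> = transmission_mat n G - gain_dist_mat n G \<phi>"

definition dist_signless_laplacian :: "nat \<Rightarrow> nat pair_pre_digraph \<Rightarrow> complex mat" where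
  "dist_signless_laplacian n G = transmission_mat n G + dist_mat n G"

end

theory Submission
  imports Defs
begin

text \<open>
  The matrix \<open>\<D>\<Q>(G)\<close> is entrywise positive for \<open>n \<ge> 2\<close> and its entries are the moduli of the
  entries of \<open>\<D>\<L>(\<Phi>)\<close>, so the inequality and its equality case are an instance of Wielandt's theorem:
  equality forces \<open>\<D>\<L>(\<Phi>) = \<omega> D \<D>\<Q>(G) D\<^sup>-\<^sup>1\<close> with \<open>|\<omega>| = 1\<close> and a unitary diagonal matrix \<open>D\<close>
  with entries \<open>\<zeta>\<close>. The positive diagonal gives \<open>\<omega> = 1\<close>, and then every distance gain is
  \<open>- \<zeta> u / \<zeta> v\<close>. Since gains multiply along shortest paths, no two vertices can be at distance two,
  so the connected graph \<open>G\<close> is complete, and \<open>\<zeta>\<close> switches all its gains to \<open>-1\<close>.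
\<close>

section \<open>Positive matrices and matrices dominated by them\<close>

text \<open>Equality case of the triangle inequality. After a rotation that makes the sum
  nonnegative, every real part must reach its bound \<open>r j\<close>, which leaves no room for an
  imaginary part.\<close>

lemma sum_attains_norm_bound_imp_aligned:
  fixes z :: "'a \<Rightarrow> complex"
  assumes fin: "finite I"
    and le: "\<And>j. j \<in> I \<Longrightarrow> cmod (z j) \<le> r j"
    and eq: "cmod (sum z I) = sum r I"
    and k: "k \<in> I"
  shows "z k = of_real (r k) * sgn (sum z I)"
proof -
  define S where "S = sum z I"
  have r0: "0 \<le> r j" if "j \<in> I" for j
    using le[OF that] norm_ge_zero order_trans by blast
  show ?thesis
  proof (cases "S = 0")
    case True
    hence "sum r I = 0" using eq by (simp add: S_def)
    hence "r k = 0" using r0 fin k by (simp add: sum_nonneg_eq_0_iff)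
    thus ?thesis using le[OF k] by simp
  next
    case False
    \<comment> \<open>Multiplication by \<open>u\<close> turns the sum \<open>S\<close> onto the
      positive real axis.\<close>
    define u where "u = cnj (sgn S)"
    have u1: "cmod u = 1" using False by (simp add: u_def norm_sgn)
    have us: "u * sgn S = 1"
      using u1 complex_norm_square[of "sgn S"] by (simp add: u_def mult.commute)
    have uS: "u * S = of_real (cmod S)"
    proof -
      have "S = of_real (cmod S) * sgn S"
        using False by (simp add: sgn_eq)
      hence "u * S = of_real (cmod S) * (u * sgn S)" by (metis mult.left_commute)
      thus ?thesis by (simp add: us)
    qed
    have Re_le: "Re (u * z j) \<le> r j" if "j \<in> I" for j
      using complex_Re_le_cmod[of "u * z j"] le[OF that] u1 by (simp add: norm_mult)
    \<comment> \<open>The differences \<open>r j - Re (u * z j)\<close> are nonnegative and add up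
      to zero, so each of them vanishes.\<close>
    have "(\<Sum>j\<in>I. r j - Re (u * z j)) = sum r I - Re (u * S)"
      by (simp add: sum_subtractf S_def sum_distrib_left)
    also have "\<dots> = 0" using eq uS by (simp add: S_def)
    finally have "r k - Re (u * z k) = 0"
      using Re_le fin k by (subst (asm) sum_nonneg_eq_0_iff) auto
    hence Re_eq: "Re (u * z k) = r k" by simp
    have "cmod (u * z k) \<le> r k" using le[OF k] u1 by (simp add: norm_mult)
    hence "(Re (u * z k))\<^sup>2 + (Im (u * z k))\<^sup>2 \<le> (r k)\<^sup>2"
      using r0[OF k] by (metis cmod_power2 norm_ge_zero power_mono)
    hence "Im (u * z k) = 0" using Re_eq by simp
    hence "u * z k = of_real (r k)" using Re_eq by (simp add: complex_eq_iff)
    hence "sgn S * (u * z k) = sgn S * of_real (r k)" by simp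
    thus ?thesis using us unfolding S_def[symmetric] by (metis mult.assoc mult.commute mult_1)
  qed
qed

section \<open>Eigenvectors, similarity and scaling for the spectral radius\<close>

abbreviation real_mat :: "nat \<Rightarrow> (nat \<Rightarrow> nat \<Rightarrow> real) \<Rightarrow> complex mat" where
  "real_mat n a \<equiv> mat n n (\<lambda>(i, j). complex_of_real (a i j))"

lemma spectral_radius_nonneg:
  assumes "A \<in> carrier_mat n n" "0 < n"
  shows "0 \<le> spectral_radius A"
  using spectral_radius_mem_max(1)[OF assms] by auto

lemma spectral_radius_eigenvectorE:
  assumes A: "A \<in> carrier_mat n n" and n: "0 < n"
  obtains x k where "x \<in> carrier_vec n" "x \<noteq> 0\<^sub>v n" "A *\<^sub>v x = k \<cdot>\<^sub>v x" "cmod k = spectral_radius A"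
proof -
  obtain k where k: "k \<in> spectrum A" "cmod k = spectral_radius A"
    using spectral_radius_mem_max(1)[OF A n] by auto
  then obtain x where "eigenvector A x k" by (auto simp: spectrum_def eigenvalue_def)
  thus thesis using that k A by (auto simp: eigenvector_def)
qed

lemma eigenvector_norm_le_spectral_radius:
  assumes A: "A \<in> carrier_mat n n" and n: "0 < n"
    and "x \<in> carrier_vec n" "x \<noteq> 0\<^sub>v n" "A *\<^sub>v x = k \<cdot>\<^sub>v x"
  shows "cmod k \<le> spectral_radius A"
proof -
  have "eigenvector A x k" using assms by (auto simp: eigenvector_def)
  hence "k \<in> spectrum A" by (auto simp: spectrum_def eigenvalue_def)
  thus ?thesis using spectral_radius_mem_max(2)[OF A n] by auto
qed

lemma spectral_radius_similar:
  assumes "similar_mat A B"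
  shows "spectral_radius A = spectral_radius B"
proof -
  obtain n where "A \<in> carrier_mat n n" "B \<in> carrier_mat n n"
    using similar_matD[OF assms] by auto
  hence "eigenvalue A = eigenvalue B"
    using char_poly_similar[OF assms] by (simp add: fun_eq_iff eigenvalue_root_char_poly)
  thus ?thesis by (simp add: spectral_radius_def spectrum_def)
qed

lemma spectral_radius_smult_le:
  assumes A: "A \<in> carrier_mat n n" and n: "0 < n" and r: "0 < r"
  shows "spectral_radius (complex_of_real (1 / r) \<cdot>\<^sub>m A) \<le> spectral_radius A / r"
proof -
  let ?B = "complex_of_real (1 / r) \<cdot>\<^sub>m A"
  have B: "?B \<in> carrier_mat n n" using A by simp
  obtain x k where x: "x \<in> carrier_vec n" "x \<noteq> 0\<^sub>v n" "?B *\<^sub>v x = k \<cdot>\<^sub>v x"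
    and k: "cmod k = spectral_radius ?B"
    using spectral_radius_eigenvectorE[OF B n] by blast
  have "A *\<^sub>v x = complex_of_real r \<cdot>\<^sub>v (?B *\<^sub>v x)"
    using A x(1) r by (intro eq_vecI) (auto simp: scalar_prod_def sum_distrib_left)
  also have "\<dots> = (complex_of_real r * k) \<cdot>\<^sub>v x"
    unfolding x(3) by (rule smult_smult_assoc)
  finally have "cmod (complex_of_real r * k) \<le> spectral_radius A"
    by (rule eigenvector_norm_le_spectral_radius[OF A n x(1,2)])
  thus ?thesis using r k by (simp add: norm_mult field_simps)
qed

text \<open>Nonnegative matrices preserve inequalities between vectors, so the subinvariance of
  \<open>y\<close> can be iterated. The real array \<open>p\<close> makes the order available for
  powers of a complex matrix.\<close>

lemma nonneg_mat_power_lower_bound: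
  fixes a :: "nat \<Rightarrow> nat \<Rightarrow> real"
  assumes a: "\<And>i j. i < n \<Longrightarrow> j < n \<Longrightarrow> 0 \<le> a i j"
    and c: "0 \<le> c"
    and le: "\<And>i. i < n \<Longrightarrow> c * y i \<le> (\<Sum>j<n. a i j * y j)"
  shows "\<exists>p. real_mat n a ^\<^sub>m k = real_mat n p \<and> (\<forall>i<n. \<forall>j<n. 0 \<le> p i j) \<and>
    (\<forall>i<n. c ^ k * y i \<le> (\<Sum>j<n. p i j * y j))"
proof (induction k)
  case 0
  have "real_mat n a ^\<^sub>m 0 = real_mat n (\<lambda>i j. if i = j then 1 else 0)"
    by (intro eq_matI) auto
  moreover have "(\<Sum>j<n. (if i = j then 1 else 0) * y j) = y i" if "i < n" for i
  proof -
    have "(\<Sum>j<n. (if i = j then 1 else 0) * y j) = (\<Sum>j<n. if i = j then y j else 0)"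
      by (intro sum.cong) auto
    thus ?thesis using that by simp
  qed
  ultimately show ?case
    by (intro exI[of _ "\<lambda>i j. if i = j then 1 else 0"]) auto
next
  case (Suc k)
  then obtain p where p: "real_mat n a ^\<^sub>m k = real_mat n p" "\<forall>i<n. \<forall>j<n. 0 \<le> p i j"
    "\<forall>i<n. c ^ k * y i \<le> (\<Sum>j<n. p i j * y j)" by blast
  define q where "q = (\<lambda>i j. \<Sum>l<n. p i l * a l j)"
  have "real_mat n a ^\<^sub>m Suc k = real_mat n q"
    unfolding pow_mat.simps p(1)
    by (intro eq_matI) (auto simp: q_def scalar_prod_def lessThan_atLeast0)
  moreover have "\<forall>i<n. \<forall>j<n. 0 \<le> q i j"
    using p(2) a by (auto simp: q_def intro!: sum_nonneg)
  moreover have "c ^ Suc k * y i \<le> (\<Sum>j<n. q i j * y j)" if i: "i < n" for i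
  proof -
    have "c ^ Suc k * y i = c * (c ^ k * y i)" by simp
    also have "\<dots> \<le> c * (\<Sum>l<n. p i l * y l)"
      using p(3) i c by (intro mult_left_mono) auto
    also have "\<dots> = (\<Sum>l<n. p i l * (c * y l))"
      by (simp add: sum_distrib_left mult_ac)
    also have "\<dots> \<le> (\<Sum>l<n. p i l * (\<Sum>j<n. a l j * y j))"
      using p(2) i le by (intro sum_mono mult_left_mono) auto
    also have "\<dots> = (\<Sum>l<n. \<Sum>j<n. p i l * a l j * y j)"
      by (simp add: sum_distrib_left mult_ac)
    also have "\<dots> = (\<Sum>j<n. \<Sum>l<n. p i l * a l j * y j)"
      by (rule sum.swap)
    also have "\<dots> = (\<Sum>j<n. q i j * y j)"
      by (simp add: q_def sum_distrib_right)
    finally show ?thesis .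
  qed
  ultimately show ?case by blast
qed

text \<open>The Collatz-Wielandt lower bound: otherwise the powers of \<open>A / r\<close>, where
  \<open>\<rho>(A) < r < c\<close>, would be bounded although they stretch \<open>y\<close> by at least \<open>(c / r) ^ k\<close>.\<close>

lemma spectral_radius_ge_subinvariant:
  fixes a :: "nat \<Rightarrow> nat \<Rightarrow> real"
  assumes a: "\<And>i j. i < n \<Longrightarrow> j < n \<Longrightarrow> 0 \<le> a i j"
    and y: "\<And>i. i < n \<Longrightarrow> 0 \<le> y i" and i0: "i0 < n" "0 < y i0"
    and le: "\<And>i. i < n \<Longrightarrow> c * y i \<le> (\<Sum>j<n. a i j * y j)"
  shows "c \<le> spectral_radius (real_mat n a)"
proof (rule ccontr)
  let ?A = "real_mat n a"
  assume "\<not> ?thesis"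
  then obtain r where r: "spectral_radius ?A < r" "r < c"
    using dense[of "spectral_radius ?A" c] by (auto simp: not_le)
  have A: "?A \<in> carrier_mat n n" and n: "0 < n" using i0 by auto
  have r0: "0 < r" using spectral_radius_nonneg[OF A n] r by linarith
  define b where "b = (\<lambda>i j. a i j / r)"
  have B_eq: "complex_of_real (1 / r) \<cdot>\<^sub>m ?A = real_mat n b"
    by (intro eq_matI) (auto simp: b_def)
  have "spectral_radius (real_mat n b) < 1"
    using spectral_radius_smult_le[OF A n r0] r r0 unfolding B_eq
    by (smt (verit) divide_less_eq_1)
  \<comment> \<open>One constant \<open>M\<close> bounds the entries of all powers at once.\<close>
  then obtain M where M: "\<And>k. norm_bound (real_mat n b ^\<^sub>m k) M"
    using spectral_radius_jnf_norm_bound_less_1_upper_triangular[of "real_mat n b" n] by auto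
  have bound: "(c / r) ^ k * y i0 \<le> M * (\<Sum>j<n. y j)" for k
  proof -
    have "0 \<le> c / r" using r r0 by simp
    moreover have "c / r * y i \<le> (\<Sum>j<n. b i j * y j)" if "i < n" for i
    proof -
      have "c / r * y i = (c * y i) / r" by simp
      also have "\<dots> \<le> (\<Sum>j<n. a i j * y j) / r"
        using le[OF that] r0 by (intro divide_right_mono) auto
      finally show ?thesis by (simp add: b_def sum_divide_distrib)
    qed
    ultimately obtain p where p: "real_mat n b ^\<^sub>m k = real_mat n p"
      "\<forall>i<n. \<forall>j<n. 0 \<le> p i j" "\<forall>i<n. (c / r) ^ k * y i \<le> (\<Sum>j<n. p i j * y j)"
      using nonneg_mat_power_lower_bound[of n b "c / r" y k] a r0 by (auto simp: b_def)
    have pM: "p i0 j \<le> M" if "j < n" for j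
      using M[of k] p(1,2) i0(1) that by (auto simp: norm_bound_def)
    have "(c / r) ^ k * y i0 \<le> (\<Sum>j<n. p i0 j * y j)" using p(3) i0(1) by blast
    also have "\<dots> \<le> (\<Sum>j<n. M * y j)"
      using pM y by (intro sum_mono mult_right_mono) auto
    finally show ?thesis by (simp add: sum_distrib_left)
  qed
  have "1 < c / r" using r r0 by simp
  then obtain k where "M * (\<Sum>j<n. y j) / y i0 < (c / r) ^ k"
    using real_arch_pow by blast
  thus False using bound[of k] i0(2) by (simp add: divide_less_eq)
qed

text \<open>If the inequality were strict in one coordinate, one more application of the positive
  matrix would make it strict in all coordinates for \<open>z\<close>, the image of
  \<open>y\<close>. Then some \<open>c\<close> above the spectral radius would satisfy the
  Collatz-Wielandt bound.\<close>

lemma positive_mat_subinvariant_is_eigenvector: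
  fixes a :: "nat \<Rightarrow> nat \<Rightarrow> real"
  assumes a: "\<And>i j. i < n \<Longrightarrow> j < n \<Longrightarrow> 0 < a i j"
    and y: "\<And>i. i < n \<Longrightarrow> 0 \<le> y i" and i0: "i0 < n" "0 < y i0"
    and le: "\<And>i. i < n \<Longrightarrow> spectral_radius (real_mat n a) * y i \<le> (\<Sum>j<n. a i j * y j)"
    and i: "i < n"
  shows "(\<Sum>j<n. a i j * y j) = spectral_radius (real_mat n a) * y i" and "0 < y i"
proof -
  let ?\<rho> = "spectral_radius (real_mat n a)"
  define z where "z = (\<lambda>i. \<Sum>j<n. a i j * y j)"
  have z0: "0 < z i" if "i < n" for i
    unfolding z_def using i0 a[OF that] y by (intro sum_pos2[of _ i0]) (simp_all add: less_imp_le)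
  have eq: "z l = ?\<rho> * y l" if l: "l < n" for l
  proof (rule ccontr)
    assume ne: "z l \<noteq> ?\<rho> * y l"
    have stretch: "?\<rho> * z i < (\<Sum>j<n. a i j * z j)" if i: "i < n" for i
    proof -
      \<comment> \<open>The vector \<open>z - ?\<rho> * y\<close> is nonnegative with a positive
        entry at \<open>l\<close>, and row \<open>i\<close> of the matrix is positive.\<close>
      have "0 < (\<Sum>j<n. a i j * (z j - ?\<rho> * y j))"
      proof (rule sum_pos2[of _ l])
        have "?\<rho> * y l < z l" using le[OF l] ne by (simp add: z_def)
        thus "0 < a i l * (z l - ?\<rho> * y l)" using a[OF i l] by simp
        show "0 \<le> a i j * (z j - ?\<rho> * y j)" if "j \<in> {..<n}" for j
          using a[OF i, of j] le[of j] that by (simp add: z_def)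
      qed (use l in auto)
      also have "\<dots> = (\<Sum>j<n. a i j * z j) - ?\<rho> * z i"
        by (simp add: z_def sum_subtractf right_diff_distrib sum_distrib_left mult.left_commute)
      finally show ?thesis by simp
    qed
    \<comment> \<open>The largest constant by which the matrix stretches every entry of
      \<open>z\<close>; as a minimum of finitely many ratios it stays strictly above
      \<open>?\<rho>\<close>.\<close>
    define c where "c = Min ((\<lambda>i. (\<Sum>j<n. a i j * z j) / z i) ` {..<n})"
    have "?\<rho> < c"
      unfolding c_def using stretch z0 i0 by (subst Min_gr_iff) (auto simp: field_simps)
    moreover have "c \<le> ?\<rho>"
    proof (rule spectral_radius_ge_subinvariant[of n a z i0 c])
      fix i assume i: "i < n"
      have "c \<le> (\<Sum>j<n. a i j * z j) / z i"
        unfolding c_def using i by (intro Min_le) auto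
      thus "c * z i \<le> (\<Sum>j<n. a i j * z j)" using z0[OF i] by (simp add: field_simps)
    qed (use a z0 i0 in \<open>auto simp: less_imp_le\<close>)
    ultimately show False by simp
  qed
  show "(\<Sum>j<n. a i j * y j) = ?\<rho> * y i" using eq[OF i] by (simp add: z_def)
  show "0 < y i" using eq[OF i] z0[OF i] y[OF i] by (cases "y i = 0") auto
qed

section \<open>Wielandt's theorem on a complex matrix dominated by a positive one\<close>

context
  fixes n :: nat and a :: "nat \<Rightarrow> nat \<Rightarrow> real" and B :: "complex mat"
  assumes n: "0 < n" and B: "B \<in> carrier_mat n n"
    and a: "\<And>i j. i < n \<Longrightarrow> j < n \<Longrightarrow> 0 < a i j"
    and dom: "\<And>i j. i < n \<Longrightarrow> j < n \<Longrightarrow> cmod (B $$ (i, j)) \<le> a i j"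
begin

text \<open>By the triangle inequality, the moduli of an eigenvector of \<open>B\<close> form a
  subinvariant vector of the dominating matrix.\<close>

lemma dominated_eigenvector:
  assumes x: "x \<in> carrier_vec n" "B *\<^sub>v x = k \<cdot>\<^sub>v x" and i: "i < n"
  shows "(\<Sum>j<n. B $$ (i, j) * x $ j) = k * x $ i"
    and "cmod k * cmod (x $ i) \<le> (\<Sum>j<n. a i j * cmod (x $ j))"
proof -
  have "(B *\<^sub>v x) $ i = (\<Sum>j<n. B $$ (i, j) * x $ j)"
    using B x(1) i by (auto simp: scalar_prod_def lessThan_atLeast0)
  thus eq: "(\<Sum>j<n. B $$ (i, j) * x $ j) = k * x $ i"
    using x i by simp
  have "cmod k * cmod (x $ i) = cmod (\<Sum>j<n. B $$ (i, j) * x $ j)"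
    by (simp add: eq norm_mult)
  also have "\<dots> \<le> (\<Sum>j<n. a i j * cmod (x $ j))"
    using dom[OF i] by (intro sum_norm_le) (auto simp: norm_mult intro: mult_right_mono)
  finally show "cmod k * cmod (x $ i) \<le> (\<Sum>j<n. a i j * cmod (x $ j))" .
qed

lemma spectral_radius_le_dominating:
  "spectral_radius B \<le> spectral_radius (real_mat n a)"
proof -
  obtain x k where x: "x \<in> carrier_vec n" "x \<noteq> 0\<^sub>v n" "B *\<^sub>v x = k \<cdot>\<^sub>v x"
    and k: "cmod k = spectral_radius B"
    using spectral_radius_eigenvectorE[OF B n] by blast
  obtain i0 where i0: "i0 < n" "x $ i0 \<noteq> 0" using x(1,2) by (metis eq_vecI carrier_vecD index_zero_vec)
  show ?thesis unfolding k[symmetric]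
    using dominated_eigenvector(2)[OF x(1,3)] i0 a
    by (intro spectral_radius_ge_subinvariant[of n a "\<lambda>i. cmod (x $ i)" i0]) (auto simp: less_imp_le)
qed

text \<open>Equality turns the moduli of an extremal eigenvector \<open>x\<close> into a positive
  eigenvector of the dominating matrix. Hence the triangle inequality is sharp in every row, which
  fixes the modulus and the phase of each entry of \<open>B\<close>.\<close>

lemma spectral_radius_eq_dominating:
  assumes eq: "spectral_radius B = spectral_radius (real_mat n a)"
  obtains \<omega> \<zeta> where "cmod \<omega> = 1" "\<And>i. i < n \<Longrightarrow> cmod (\<zeta> i) = 1"
    "\<And>i j. i < n \<Longrightarrow> j < n \<Longrightarrow> B $$ (i, j) = \<omega> * \<zeta> i * of_real (a i j) / \<zeta> j"
proof -
  obtain x k where x: "x \<in> carrier_vec n" "x \<noteq> 0\<^sub>v n" "B *\<^sub>v x = k \<cdot>\<^sub>v x"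
    and k: "cmod k = spectral_radius B"
    using spectral_radius_eigenvectorE[OF B n] by blast
  obtain i0 where i0: "i0 < n" "x $ i0 \<noteq> 0" using x(1,2) by (metis eq_vecI carrier_vecD index_zero_vec)
  note perron = positive_mat_subinvariant_is_eigenvector[of n a "\<lambda>i. cmod (x $ i)" i0,
      OF a _ i0(1) _ dominated_eigenvector(2)[OF x(1,3), unfolded k eq]]
  have x0: "x $ i \<noteq> 0" if "i < n" for i using perron(2)[OF _ _ _ _ _ that] i0 by auto
  have sum_eq: "(\<Sum>j<n. a i j * cmod (x $ j)) = cmod k * cmod (x $ i)" if "i < n" for i
    using perron(1)[OF _ _ _ _ _ that] i0 k eq by auto
  \<comment> \<open>A nonzero eigenvalue is what makes \<open>sgn k\<close> unimodular.\<close>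
  have k0: "k \<noteq> 0"
  proof
    assume "k = 0"
    moreover have "0 < (\<Sum>j<n. a i0 j * cmod (x $ j))"
      using a x0 i0 by (intro sum_pos) auto
    ultimately show False using sum_eq[OF i0(1)] by simp
  qed
  show thesis
  \<comment> \<open>The witnesses are the phases of the eigenvalue and of the entries of its
    eigenvector.\<close>
  proof (rule that[of "sgn k" "\<lambda>i. sgn (x $ i)"])
    show "cmod (sgn k) = 1" using k0 by (simp add: norm_sgn)
    show "cmod (sgn (x $ i)) = 1" if "i < n" for i using x0[OF that] by (simp add: norm_sgn)
    fix i j assume i: "i < n" and j: "j < n"
    \<comment> \<open>All terms of row \<open>i\<close> share the phase of their sum
      \<open>k * x $ i\<close>.\<close>
    have "B $$ (i, j) * x $ j = of_real (a i j * cmod (x $ j)) * sgn (\<Sum>j<n. B $$ (i, j) * x $ j)"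
    proof (rule sum_attains_norm_bound_imp_aligned)
      show "cmod (\<Sum>j<n. B $$ (i, j) * x $ j) = (\<Sum>j<n. a i j * cmod (x $ j))"
        using dominated_eigenvector(1)[OF x(1,3) i] sum_eq[OF i] by (simp add: norm_mult)
    qed (use j dom[OF i] in \<open>auto simp: norm_mult intro: mult_right_mono\<close>)
    also have "\<dots> = of_real (a i j) * of_real (cmod (x $ j)) * (sgn k * sgn (x $ i))"
      by (simp add: dominated_eigenvector(1)[OF x(1,3) i] sgn_mult)
    finally show "B $$ (i, j) = sgn k * sgn (x $ i) * of_real (a i j) / sgn (x $ j)"
      using x0[OF j] by (simp add: sgn_eq[of "x $ j"] field_simps)
  qed
qed

end

lemma spectral_radius_diagonal_conjugate:
  fixes A B :: "complex mat"
  assumes A: "A \<in> carrier_mat n n" and B: "B \<in> carrier_mat n n"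
    and \<zeta>: "\<And>i. i < n \<Longrightarrow> \<zeta> i \<noteq> 0"
    and conj: "\<And>i j. i < n \<Longrightarrow> j < n \<Longrightarrow> B $$ (i, j) = \<zeta> i * A $$ (i, j) / \<zeta> j"
  shows "spectral_radius B = spectral_radius A"
proof (rule spectral_radius_similar, rule similar_matI)
  let ?P = "mat n n (\<lambda>(i, j). if i = j then \<zeta> i else 0)"
  let ?Q = "mat n n (\<lambda>(i, j). if i = j then 1 / \<zeta> i else 0)"
  \<comment> \<open>Sums against a diagonal matrix collapse to a single term.\<close>
  have if_l: "(\<Sum>k<n. (if i = k then f k else 0) * g k) = f i * g i"
    and if_r: "(\<Sum>k<n. g k * (if k = i then f k else 0)) = g i * f i"
    if "i < n" for i and f g :: "nat \<Rightarrow> complex"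
    using that by (simp_all add: if_distrib[of "\<lambda>x. x * _"] if_distrib[of "\<lambda>x. _ * x"] cong: if_cong)
  note simps = scalar_prod_def lessThan_atLeast0[symmetric] if_l if_r \<zeta>
  show "{B, A, ?P, ?Q} \<subseteq> carrier_mat n n" using A B by auto
  show "?P * ?Q = 1\<^sub>m n" "?Q * ?P = 1\<^sub>m n"
    by (auto intro!: eq_matI simp: simps)
  have PA: "?P * A = mat n n (\<lambda>(i, j). \<zeta> i * A $$ (i, j))"
    using A by (auto intro!: eq_matI simp: simps)
  show "B = ?P * A * ?Q"
    unfolding PA using B by (auto intro!: eq_matI simp: simps conj)
qed

section \<open>Shortest paths and their gains\<close>

text \<open>The description in \<open>lex_Max\<close> denotes only if a maximum exists and is
  unique; finiteness and totality give existence, antisymmetry gives uniqueness.\<close>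

lemma lex_Max_in:
  assumes "finite S" "S \<noteq> {}"
  shows "lex_Max S \<in> S"
proof -
  have trans: "lex_le x z" if "lex_le x y" "lex_le y z" for x y z
    using that by (auto simp: lex_le_def)
  have total: "lex_le x y \<or> lex_le y x" for x y by (auto simp: lex_le_def)
  have refl: "lex_le x x" for x by (simp add: lex_le_def)
  have "\<exists>z\<in>S. \<forall>w\<in>S. lex_le w z"
    using assms
  proof (induction S rule: finite_ne_induct)
    case (insert x F)
    then obtain z where "z \<in> F" "\<forall>w\<in>F. lex_le w z" by blast
    thus ?case using total[of x z] trans refl by blast
  qed (simp add: refl)
  moreover have "x = y" if "lex_le x y" "lex_le y x" for x y
    using that by (auto simp: lex_le_def complex_eq_iff)
  ultimately have "\<exists>!z. z \<in> S \<and> (\<forall>w\<in>S. lex_le w z)" by blast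
  from theI'[OF this] show ?thesis by (simp add: lex_Max_def)
qed

section \<open>Distances and shortest paths in a simple graph\<close>

context pair_graph
begin

lemma gdist_le_length: "apath u p v \<Longrightarrow> gdist G u v \<le> length p"
  unfolding gdist_def by (rule Least_le) blast

lemma shortest_pathsD:
  assumes "p \<in> shortest_paths G u v"
  shows "apath u p v" and "length p = gdist G u v"
  using assms by (auto simp: shortest_paths_def)

lemma finite_shortest_paths: "finite (shortest_paths G u v)"
  by (rule finite_subset[OF _ apaths_finite[of u v]]) (auto simp: shortest_paths_def)

lemma shortest_paths_nonempty:
  assumes "apath u p v"
  shows "shortest_paths G u v \<noteq> {}"
proof -
  have "\<exists>q. apath u q v \<and> length q = gdist G u v"
    unfolding gdist_def by (rule LeastI_ex) (use assms in blast)
  thus ?thesis by (auto simp: shortest_paths_def)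
qed

lemma gdist_self: "u \<in> pverts G \<Longrightarrow> gdist G u u = 0"
  using gdist_le_length[of u "[]" u] by (simp add: apath_Nil_iff)

lemma gdist_pos:
  assumes "apath u p v" "u \<noteq> v"
  shows "0 < gdist G u v"
  using shortest_paths_nonempty[OF assms(1)] assms(2)
  by (auto simp: shortest_paths_def apath_Nil_iff intro!: Nat.gr0I)

lemma arc_sym: "(u, v) \<in> parcs G \<Longrightarrow> (v, u) \<in> parcs G"
  using pair_sym_arcs by (auto simp: symmetric_def dest: symD)

lemma arc_neq: "(u, v) \<in> parcs G \<Longrightarrow> u \<noteq> v"
  using pair_no_loops by fastforce

lemma apath_arc: "(u, v) \<in> parcs G \<Longrightarrow> apath u [(u, v)] v"
  using arc_neq by (auto simp: apath_simps in_arcsD2)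

lemma gdist_arc: "(u, v) \<in> parcs G \<Longrightarrow> gdist G u v = 1"
  using gdist_le_length[OF apath_arc] gdist_pos[OF apath_arc] arc_neq by fastforce

lemma shortest_paths_arc:
  assumes "(u, v) \<in> parcs G"
  shows "shortest_paths G u v = {[(u, v)]}"
proof -
  have "p = [(u, v)]" if "p \<in> shortest_paths G u v" for p
    using shortest_pathsD[OF that] gdist_arc[OF assms]
    by (cases p) (auto simp: apath_simps)
  thus ?thesis using shortest_paths_nonempty[OF apath_arc[OF assms]] by blast
qed

text \<open>The detour through \<open>w\<close> bounds the distance by two, while lengths zero and
  one are excluded by \<open>u \<noteq> v\<close> and the missing arc.\<close>

lemma shortest_path_via:
  assumes arcs: "(u, w) \<in> parcs G" "(w, v) \<in> parcs G" and ne: "u \<noteq> v" and na: "(u, v) \<notin> parcs G"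
    and p: "p \<in> shortest_paths G u v"
  obtains x where "p = [(u, x), (x, v)]" "(u, x) \<in> parcs G" "(x, v) \<in> parcs G"
proof -
  have "apath u [(u, w), (w, v)] v"
    using arcs ne arc_neq by (auto simp: apath_simps in_arcsD2)
  hence "length p \<le> 2" using gdist_le_length shortest_pathsD(2)[OF p] by fastforce
  with shortest_pathsD(1)[OF p] ne na that show thesis
    by (cases p; cases "tl p") (auto simp: apath_simps)
qed

text \<open>Connectedness of a digraph concerns its symmetric closure; symmetry of the arcs upgrades
  it to directed reachability.\<close>

lemma connected_apath:
  assumes "Digraph_Component.connected (with_proj G)" "u \<in> pverts G" "v \<in> pverts G"
  shows "u \<rightarrow>\<^sup>*\<^bsub>with_proj G\<^esub> v" and "\<exists>p. apath u p v"
proof -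
  have "strongly_connected (with_proj G)"
    using symmetric_connected_imp_strongly_connected[OF pair_sym_arcs assms(1)] .
  thus r: "u \<rightarrow>\<^sup>*\<^bsub>with_proj G\<^esub> v" using assms(2,3) by (auto simp: strongly_connected_def)
  thus "\<exists>p. apath u p v" using reachable_awalk apath_awalk_to_apath by blast
qed

text \<open>Induction along a walk from \<open>u\<close>: transitivity shortcuts each new step, so
  every vertex reached is \<open>u\<close> itself or adjacent to it.\<close>

lemma transitive_arcs_imp_complete:
  assumes conn: "Digraph_Component.connected (with_proj G)"
    and trans: "\<And>u w v. (u, w) \<in> parcs G \<Longrightarrow> (w, v) \<in> parcs G \<Longrightarrow> u \<noteq> v \<Longrightarrow> (u, v) \<in> parcs G"
  shows "complete_digraph (card (pverts G)) (with_proj G)"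
proof -
  have "u = v \<or> (u, v) \<in> parcs G" if "u \<in> pverts G" "v \<in> pverts G" for u v
    using connected_apath(1)[OF conn that]
  proof (induction rule: reachable_induct)
    case (step x y)
    thus ?case using trans[of u x y] by auto
  qed simp
  thus ?thesis
    using pair_finite_verts arc_neq in_arcsD1 in_arcsD2
    by (auto simp: complete_digraph_pair_def)
qed

end

section \<open>Gains of shortest paths\<close>

lemma gain_graphD:
  assumes "gain_graph G \<phi>" "(u, v) \<in> parcs G"
  shows "cmod (\<phi> (u, v)) = 1" and "\<phi> (v, u) = cnj (\<phi> (u, v))"
  using assms by (auto simp: gain_graph_def)

lemma norm_path_gain:
  assumes "gain_graph G \<phi>" "set p \<subseteq> parcs G"
  shows "cmod (path_gain \<phi> p) = 1"
  using assms(2)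
proof (induction p)
  case (Cons e p)
  thus ?case using gain_graphD(1)[OF assms(1), of "fst e" "snd e"]
    by (simp add: path_gain_def norm_mult)
qed (simp add: path_gain_def)

context
  fixes G :: "nat pair_pre_digraph" and \<phi> :: "nat \<times> nat \<Rightarrow> complex"
  assumes gg: "gain_graph G \<phi>"
begin

interpretation pair_graph G using gg by (simp add: gain_graph_def)

lemma lex_Max_shortest_path:
  assumes "apath u p v"
  obtains q where "q \<in> shortest_paths G u v"
    "lex_Max (path_gain \<phi> ` shortest_paths G u v) = path_gain \<phi> q"
  using lex_Max_in[of "path_gain \<phi> ` shortest_paths G u v"] finite_shortest_paths
    shortest_paths_nonempty[OF assms] by blast

lemma norm_lex_Max_shortest_path:
  assumes "apath u p v"
  shows "cmod (lex_Max (path_gain \<phi> ` shortest_paths G u v)) = 1"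
  using lex_Max_shortest_path[OF assms] norm_path_gain[OF gg]
  by (metis awalkI_apath awalk_def shortest_pathsD(1))

lemma norm_gain_max:
  assumes conn: "Digraph_Component.connected (with_proj G)"
    and uv: "u \<in> pverts G" "v \<in> pverts G" "u \<noteq> v"
  shows "cmod (gain_max (<) G \<phi> u v) = 1"
  using connected_apath(2)[OF conn uv(1,2)] connected_apath(2)[OF conn uv(2,1)] uv(3)
  by (auto simp: gain_max_def norm_lex_Max_shortest_path)

text \<open>The arc is the only shortest path between its ends, so the maximum is over a singleton.
  For \<open>u > v\<close> the conjugate in \<open>gain_max\<close> cancels against that in the gain
  of the reversed arc.\<close>

lemma gain_max_arc:
  assumes arc: "(u, v) \<in> parcs G"
  shows "gain_max (<) G \<phi> u v = \<phi> (u, v)"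
proof -
  have "lex_Max {z} = z" for z using lex_Max_in[of "{z}"] by simp
  thus ?thesis
    using arc_neq[OF arc] shortest_paths_arc[OF arc] shortest_paths_arc[OF arc_sym[OF arc]]
      gain_graphD(2)[OF gg arc]
    by (simp add: gain_max_def path_gain_def)
qed

text \<open>A pair at distance two would have gain \<open>(-1)\<^sup>2 \<zeta> u / \<zeta> v\<close> along the path, but
  \<open>- \<zeta> u / \<zeta> v\<close> by hypothesis.\<close>

lemma antibalanced_distances_imp_transitive:
  assumes \<zeta>: "\<And>u. u \<in> pverts G \<Longrightarrow> \<zeta> u \<noteq> 0"
    and gain: "\<And>u v. u \<in> pverts G \<Longrightarrow> v \<in> pverts G \<Longrightarrow> u \<noteq> v \<Longrightarrow> gain_max (<) G \<phi> u v = - \<zeta> u / \<zeta> v"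
    and arcs: "(u, w) \<in> parcs G" "(w, v) \<in> parcs G" and ne: "u \<noteq> v"
  shows "(u, v) \<in> parcs G"
proof -
  \<comment> \<open>For \<open>u < v\<close>, \<open>gain_max\<close> is the gain of an actual path
    from \<open>u\<close> to \<open>v\<close>, without conjugation.\<close>
  have less: "(u, v) \<in> parcs G"
    if arcs: "(u, w) \<in> parcs G" "(w, v) \<in> parcs G" and lt: "u < v" for u v
  proof (rule ccontr)
    assume na: "(u, v) \<notin> parcs G"
    have "apath u [(u, w), (w, v)] v"
      using arcs lt arc_neq by (auto simp: apath_simps in_arcsD2)
    then obtain q where q: "q \<in> shortest_paths G u v"
      "lex_Max (path_gain \<phi> ` shortest_paths G u v) = path_gain \<phi> q"
      by (rule lex_Max_shortest_path)
    obtain x where x: "q = [(u, x), (x, v)]" "(u, x) \<in> parcs G" "(x, v) \<in> parcs G"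
      using shortest_path_via[OF arcs _ na q(1)] lt by blast
    have arc_gain: "\<phi> (s, t) = - \<zeta> s / \<zeta> t" if "(s, t) \<in> parcs G" for s t
      using gain gain_max_arc[OF that] arc_neq[OF that] in_arcsD1[OF that] in_arcsD2[OF that] by simp
    have verts: "u \<in> pverts G" "x \<in> pverts G" "v \<in> pverts G"
      using x in_arcsD1 in_arcsD2 by auto
    have "- \<zeta> u / \<zeta> v = path_gain \<phi> q"
      using gain[OF verts(1,3)] lt q(2) by (simp add: gain_max_def)
    also have "\<dots> = \<zeta> u / \<zeta> v"
      using \<zeta>[OF verts(2)] by (simp add: x(1) path_gain_def arc_gain[OF x(2)] arc_gain[OF x(3)])
    finally show False using \<zeta> verts by simp
  qed
  show ?thesis
    \<comment> \<open>The case \<open>v < u\<close> follows by reversing both arcs.\<close>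
    using less[OF arcs] less[OF arc_sym[OF arcs(2)] arc_sym[OF arcs(1)]] ne arc_sym
    by (cases u v rule: linorder_cases) auto
qed

end

section \<open>The distance Laplacian\<close>

text \<open>A real-valued form of the entries of \<open>dist_signless_laplacian\<close>, which
  allows comparison with the moduli of the complex entries of
  \<open>gain_dist_laplacian\<close>.\<close>

definition signless_laplacian_entry :: "nat pair_pre_digraph \<Rightarrow> nat \<Rightarrow> nat \<Rightarrow> real" where
  "signless_laplacian_entry G i j = (if i = j then real (transmission G i) else real (gdist G i j))"

context
  fixes n :: nat and G :: "nat pair_pre_digraph" and \<phi> :: "nat \<times> nat \<Rightarrow> complex"
  assumes gg: "gain_graph G \<phi>" and verts: "pverts G = {..<n}"
    and conn: "Digraph_Component.connected (with_proj G)"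
begin

interpretation pair_graph G using gg by (simp add: gain_graph_def)

lemma gain_dist_laplacian_carrier: "gain_dist_laplacian n G \<phi> \<in> carrier_mat n n"
  unfolding gain_dist_laplacian_def gain_dist_mat_def gain_dist_mat_max_def transmission_mat_def
  by (intro minus_carrier_mat mat_carrier)

lemma gain_dist_laplacian_index:
  assumes "i < n" "j < n"
  shows "gain_dist_laplacian n G \<phi> $$ (i, j) = (if i = j then of_nat (transmission G i)
    else - gain_max (<) G \<phi> i j * of_nat (gdist G i j))"
  using assms
  by (simp add: gain_dist_laplacian_def transmission_mat_def gain_dist_mat_def
      gain_dist_mat_max_def gain_max_def)

lemma dist_signless_laplacian_eq: "dist_signless_laplacian n G = real_mat n (signless_laplacian_entry G)"
  using gdist_self
  by (intro eq_matI) (auto simp: dist_signless_laplacian_def transmission_mat_def dist_mat_def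
      signless_laplacian_entry_def verts)

lemma gdist_pos_verts: "i < n \<Longrightarrow> j < n \<Longrightarrow> i \<noteq> j \<Longrightarrow> 0 < gdist G i j"
  using connected_apath(2)[OF conn, of i j] gdist_pos verts by auto

lemma signless_laplacian_entry_pos:
  assumes "2 \<le> n" "i < n" "j < n"
  shows "0 < signless_laplacian_entry G i j"
proof -
  \<comment> \<open>A second vertex makes the transmission, and so the diagonal entry,
    positive.\<close>
  obtain k where k: "k < n" "k \<noteq> i"
    using assms(1) that[of 0] that[of 1] by (cases "i = 0") auto
  have "0 < transmission G i"
    unfolding transmission_def verts
    using gdist_pos_verts[OF assms(2) k(1)] k by (intro sum_pos2[of _ k]) auto
  thus ?thesis using gdist_pos_verts[OF assms(2,3)] by (auto simp: signless_laplacian_entry_def)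
qed

lemma norm_gain_dist_laplacian:
  assumes "i < n" "j < n"
  shows "cmod (gain_dist_laplacian n G \<phi> $$ (i, j)) = signless_laplacian_entry G i j"
  using norm_gain_max[OF gg conn, of i j] assms
  by (simp add: gain_dist_laplacian_index signless_laplacian_entry_def norm_mult verts)

text \<open>In a complete graph every distance gain is the gain of an arc. The minus sign of the
  Laplacian cancels the gain -1, so switching becomes a diagonal conjugation between the two
  matrices.\<close>

lemma spectral_radius_eq_if_antibalanced_complete:
  assumes comp: "complete_digraph n (with_proj G)"
    and sw: "switching_equivalent G \<phi> (\<lambda>_. -1)"
  shows "spectral_radius (gain_dist_laplacian n G \<phi>) = spectral_radius (dist_signless_laplacian n G)"
proof -
  obtain \<eta> where \<eta>: "\<forall>v\<in>pverts G. cmod (\<eta> v) = 1"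
    "\<forall>(u, v)\<in>parcs G. \<phi> (u, v) = inverse (\<eta> u) * - 1 * \<eta> v"
    using sw unfolding switching_equivalent_def by blast
  have \<eta>0: "\<eta> i \<noteq> 0" if "i < n" for i using \<eta>(1) that verts by force
  have arc: "(i, j) \<in> parcs G" if "i < n" "j < n" "i \<noteq> j" for i j
    using comp that by (simp add: complete_digraph_pair_def verts)
  show ?thesis
  proof (rule spectral_radius_diagonal_conjugate[where \<zeta> = "\<lambda>i. inverse (\<eta> i)"])
    show "dist_signless_laplacian n G \<in> carrier_mat n n"
      by (simp add: dist_signless_laplacian_eq)
    show "gain_dist_laplacian n G \<phi> $$ (i, j) =
        inverse (\<eta> i) * dist_signless_laplacian n G $$ (i, j) / inverse (\<eta> j)"
      if ij: "i < n" "j < n" for i j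
    proof (cases "i = j")
      case True
      thus ?thesis using ij \<eta>0[OF ij(1)]
        by (simp add: gain_dist_laplacian_index dist_signless_laplacian_eq signless_laplacian_entry_def)
    next
      case False
      have "\<phi> (i, j) = - (inverse (\<eta> i) * \<eta> j)" using \<eta>(2) arc[OF ij False] by auto
      thus ?thesis
        using ij False gain_max_arc[OF gg arc[OF ij False]] gdist_arc[OF arc[OF ij False]]
        by (simp add: gain_dist_laplacian_index dist_signless_laplacian_eq
            signless_laplacian_entry_def divide_inverse)
    qed
  qed (use \<eta>0 gain_dist_laplacian_carrier in auto)
qed

lemma complete_antibalanced_if_spectral_radius_eq:
  assumes n: "2 \<le> n"
    and eq: "spectral_radius (gain_dist_laplacian n G \<phi>) = spectral_radius (dist_signless_laplacian n G)"
  shows "complete_digraph n (with_proj G)" and "switching_equivalent G \<phi> (\<lambda>_. -1)"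
proof -
  let ?B = "gain_dist_laplacian n G \<phi>"
  obtain \<omega> \<zeta> where \<omega>: "cmod \<omega> = 1" and \<zeta>: "\<And>i. i < n \<Longrightarrow> cmod (\<zeta> i) = 1"
    and B: "\<And>i j. i < n \<Longrightarrow> j < n \<Longrightarrow>
      ?B $$ (i, j) = \<omega> * \<zeta> i * of_real (signless_laplacian_entry G i j) / \<zeta> j"
  proof (rule spectral_radius_eq_dominating[of n ?B "signless_laplacian_entry G"])
    show "cmod (?B $$ (i, j)) \<le> signless_laplacian_entry G i j" if "i < n" "j < n" for i j
      using norm_gain_dist_laplacian[OF that] by simp
  qed (use n eq gain_dist_laplacian_carrier signless_laplacian_entry_pos in
      \<open>auto simp: dist_signless_laplacian_eq\<close>)
  have \<zeta>0: "\<zeta> i \<noteq> 0" if "i < n" for i using \<zeta>[OF that] by auto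
  \<comment> \<open>In a diagonal entry the phases \<open>\<zeta>\<close> cancel, and the same
    positive transmission stands on both sides.\<close>
  have "\<omega> = 1"
    using B[of 0 0] \<zeta>0[of 0] n signless_laplacian_entry_pos[of 0 0]
    by (simp add: gain_dist_laplacian_index signless_laplacian_entry_def)
  have gain: "gain_max (<) G \<phi> u v = - \<zeta> u / \<zeta> v"
    if "u \<in> pverts G" "v \<in> pverts G" "u \<noteq> v" for u v
  proof -
    have uv: "u < n" "v < n" using that verts by auto
    have "- gain_max (<) G \<phi> u v * of_nat (gdist G u v) = \<zeta> u / \<zeta> v * of_nat (gdist G u v)"
      using B[OF uv] \<open>\<omega> = 1\<close> that(3) uv
      by (simp add: gain_dist_laplacian_index signless_laplacian_entry_def)
    hence "- gain_max (<) G \<phi> u v = \<zeta> u / \<zeta> v"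
      using gdist_pos_verts[OF uv that(3)] by (subst (asm) mult_cancel_right) auto
    thus ?thesis by (metis minus_divide_left minus_minus)
  qed
  have "complete_digraph (card (pverts G)) (with_proj G)"
    using antibalanced_distances_imp_transitive[OF gg _ gain] \<zeta>0 verts
    by (intro transitive_arcs_imp_complete[OF conn]) auto
  thus "complete_digraph n (with_proj G)" by (simp add: verts)
  \<comment> \<open>Switching puts the inverse on the tail of the arc, so the switching function is
    the inverse of \<open>\<zeta>\<close>.\<close>
  have "\<phi> (u, v) = inverse (inverse (\<zeta> u)) * - 1 * inverse (\<zeta> v)" if "(u, v) \<in> parcs G" for u v
    using gain[OF in_arcsD1[OF that] in_arcsD2[OF that] arc_neq[OF that]] gain_max_arc[OF gg that]
    by (simp add: divide_inverse)
  thus "switching_equivalent G \<phi> (\<lambda>_. -1)"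
    unfolding switching_equivalent_def using \<zeta> verts
    by (intro exI[of _ "\<lambda>i. inverse (\<zeta> i)"]) (auto simp: norm_inverse)
qed

lemma single_vertex_no_arcs:
  assumes "n = 1"
  shows "parcs G = {}"
  using in_arcsD1 in_arcsD2 arc_neq verts assms by fastforce

end

theorem theorem4p4:
  fixes n :: nat and G :: "nat pair_pre_digraph" and \<phi> :: "nat \<times> nat \<Rightarrow> complex"
  assumes "gain_graph G \<phi>"
    and "pverts G = {..<n}"
    and "Digraph_Component.connected (with_proj G)"
    and "distance_compatible n G \<phi>"
  shows "spectral_radius (gain_dist_laplacian n G \<phi>)
           \<le> spectral_radius (dist_signless_laplacian n G)
       \<and> (spectral_radius (gain_dist_laplacian n G \<phi>)
             = spectral_radius (dist_signless_laplacian n G)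
           \<longleftrightarrow> complete_digraph n (with_proj G) \<and> switching_equivalent G \<phi> (\<lambda>_. -1))"
proof -
  interpret pair_graph G using assms(1) by (simp add: gain_graph_def)
  let ?B = "gain_dist_laplacian n G \<phi>"
  note facts = assms(1-3)
  \<comment> \<open>Strong connectivity includes nonemptiness of the vertex set.\<close>
  have "n \<noteq> 0"
    using symmetric_connected_imp_strongly_connected[OF pair_sym_arcs assms(3)] assms(2)
    by (auto simp: strongly_connected_def)
  then consider "n = 1" | "2 \<le> n" by linarith
  thus ?thesis
  proof cases
    \<comment> \<open>For one vertex \<open>dist_signless_laplacian\<close> is zero and not
      positive, so Wielandt's theorem does not apply. Without arcs, completeness and switching are
      trivial, and the inequality follows from equality.\<close>
    case 1
    have "complete_digraph n (with_proj G) \<and> switching_equivalent G \<phi> (\<lambda>_. -1)"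
      using single_vertex_no_arcs[OF facts 1] assms(2) 1
      by (auto simp: complete_digraph_pair_def switching_equivalent_def intro: exI[of _ "\<lambda>_. 1"])
    thus ?thesis using spectral_radius_eq_if_antibalanced_complete[OF facts] by simp
  next
    case 2
    have "spectral_radius ?B \<le> spectral_radius (dist_signless_laplacian n G)"
      unfolding dist_signless_laplacian_eq[OF facts]
      using 2 gain_dist_laplacian_carrier[OF facts] signless_laplacian_entry_pos[OF facts]
        norm_gain_dist_laplacian[OF facts]
      by (intro spectral_radius_le_dominating) auto
    thus ?thesis
      using spectral_radius_eq_if_antibalanced_complete[OF facts]
        complete_antibalanced_if_spectral_radius_eq[OF facts 2] by blast
  qed
qed

end
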